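(* Let $L$ be an $\mathbb{F}_q$-linear set of $\mathrm{PG}(1,q^n)$ with exactly two points $P$ and $Q$ of weight greater than one. Then $w_L(P)\le \frac n2$ and $w_L(Q)\le\frac n2$. In particular, if $n$ is odd then $w_L(P)+w_L(Q)<n$. Moreover, if $w_L(P)+w_L(Q)=n$ then $n$ is even and $w_L(P)=w_L(Q)=\frac n2$.
   Context: An $\mathbb{F}_q$-linear set of $\mathrm{PG}(1,q^n)=\mathrm{PG}(\mathbb{F}_{q^n}^2,\mathbb{F}_{q^n})$ is a set $L=L_U=\{\langle \mathbf u\rangle_{\mathbb{F}_{q^n}}\colon \mathbf u\in U\setminus\{\mathbf 0\}\}$ for an $\mathbb{F}_q$-subspace $U$ of $\mathbb{F}_{q^n}^2$; the weight of a point $\langle\mathbf v\rangle_{\mathbb{F}_{q^n}}$ is $w_L(\langle\mathbf v\rangle_{\mathbb{F}_{q^n}})=\dim_{\mathbb{F}_q}(U\cap\langle\mathbf v\rangle_{\mathbb{F}_{q^n}})$. *)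

theory Defs
  imports "HOL-Analysis.Cartesian_Space"
begin

text \<open>
  The extension of GF(q) by GF(q^n) is modelled by two field types
  \<open>'k\<close> (the small field) and \<open>'a\<close> (the large field) together with a field embedding
  \<open>\<iota> :: 'k \<Rightarrow> 'a\<close>.  Injectivity of \<open>\<iota>\<close> is automatic, as \<open>'k\<close> is a field and \<open>\<iota> 1 = 1\<close>.
\<close>

definition field_embedding :: "('k::field \<Rightarrow> 'a::field) \<Rightarrow> bool" where
  "field_embedding \<iota> \<longleftrightarrow>
     \<iota> 1 = 1 \<and> (\<forall>x y. \<iota> (x + y) = \<iota> x + \<iota> y) \<and> (\<forall>x y. \<iota> (x * y) = \<iota> x * \<iota> y)"

definition sub_scale :: "('k::field \<Rightarrow> 'a::field) \<Rightarrow> 'k \<Rightarrow> 'a ^ 2 \<Rightarrow> 'a ^ 2" where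
  "sub_scale \<iota> c v = \<iota> c *s v"

lemma vector_space_sub_scale:
  assumes "field_embedding \<iota>"
  shows "vector_space (sub_scale \<iota>)"
  using assms
  by unfold_locales
    (simp_all add: field_embedding_def sub_scale_def vec.scale_right_distrib vec.scale_left_distrib)

text \<open>
  A point of the projective line over \<open>'a\<close> is represented by the one-dimensional
  \<open>'a\<close>-subspace \<open>vec.span {v}\<close> of \<open>'a ^ 2\<close> with \<open>v \<noteq> 0\<close>.
\<close>

definition linear_set :: "('a::field ^ 2) set \<Rightarrow> ('a ^ 2) set set" where
  "linear_set U = {vec.span {u} | u. u \<in> U - {0}}"

text \<open>
  The weight depends on the subspace \<open>U\<close> defining the linear set, and not only on the
  underlying point set \<open>linear_set U\<close>.
\<close>

definition weight :: "('k::field \<Rightarrow> 'a::field) \<Rightarrow> ('a ^ 2) set \<Rightarrow> ('a ^ 2) set \<Rightarrow> nat" where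
  "weight \<iota> U P = vector_space.dim (sub_scale \<iota>) (U \<inter> P)"

end

theory Submission imports Defs begin

text \<open>
  Let \<open>t\<close> and \<open>c t\<close> be two vectors of \<open>U \<inter> Q\<close> that are independent over the small field.
  If \<open>u\<close> and \<open>c u\<close> both lie in \<open>U \<inter> P\<close> with \<open>u \<noteq> 0\<close>, then \<open>u + t\<close> and \<open>c (u + t)\<close> lie in \<open>U\<close>,
  so the point spanned by \<open>u + t\<close> has weight at least two, although it is neither \<open>P\<close> nor \<open>Q\<close>.
  Hence \<open>U \<inter> P\<close> and \<open>c (U \<inter> P)\<close> are subspaces of \<open>P\<close> that meet trivially, which gives
  \<open>2 w(P) \<le> n\<close>; the other claims follow by exchanging \<open>P\<close> and \<open>Q\<close>.
\<close>

lemma (in vector_space) independent_scale_inj: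
  assumes "independent B" "finite B" "(\<Sum>b\<in>B. scale (f b) b) = (\<Sum>b\<in>B. scale (g b) b)" "b \<in> B"
  shows "f b = g b"
proof -
  have "(\<Sum>b\<in>B. scale (f b - g b) b) = 0"
    using assms(3) by (simp add: scale_left_diff_distrib sum_subtractf)
  then have "f b - g b = 0"
    using independentD[OF assms(1,2) subset_refl, of "\<lambda>b. f b - g b"] assms(4) by blast
  then show ?thesis by simp
qed

text \<open>Distinct coefficient families on a basis of \<open>W\<close> give distinct linear
  combinations, all lying in \<open>W\<close>. This turns the dimension in \<open>weight\<close>
  into a cardinality that can be compared with \<open>CARD('a)\<close>.\<close>

lemma card_power_dim_le:
  fixes scale :: "'k::{field,finite} \<Rightarrow> 'v::{ab_group_add,finite} \<Rightarrow> 'v"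
  assumes "vector_space scale" "module.subspace scale W"
  shows "CARD('k) ^ vector_space.dim scale W \<le> card W"
proof -
  interpret vector_space scale by fact
  obtain B where B: "B \<subseteq> W" "independent B" "W \<subseteq> span B" "card B = dim W"
    by (rule basis_exists)
  have fin: "finite B" by simp
  let ?g = "\<lambda>f. \<Sum>b\<in>B. scale (f b) b"
  have "inj_on ?g (B \<rightarrow>\<^sub>E UNIV)"
  proof (rule inj_onI)
    fix f g
    assume f: "f \<in> B \<rightarrow>\<^sub>E UNIV" and g: "g \<in> B \<rightarrow>\<^sub>E UNIV" and eq: "?g f = ?g g"
    show "f = g"
      using f g by (rule PiE_ext) (rule independent_scale_inj[OF B(2) fin eq])
  qed
  moreover have "?g ` (B \<rightarrow>\<^sub>E UNIV) \<subseteq> W"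
    using B(1) by (auto intro!: subspace_sum[OF assms(2)] subspace_scale[OF assms(2)])
  ultimately have "card (B \<rightarrow>\<^sub>E (UNIV :: 'k set)) \<le> card W"
    by (rule card_inj_on_le) simp
  then show ?thesis by (simp add: card_PiE[OF fin] B(4))
qed

text \<open>The vectors \<open>x\<close> and \<open>c *s x\<close> are proportional over the large
  field, but a factor outside \<open>range \<iota>\<close> keeps them independent over the small
  one.\<close>

lemma two_le_weight:
  fixes \<iota> :: "'k::{field,finite} \<Rightarrow> 'a::{field,finite}"
  assumes "field_embedding \<iota>" "c \<notin> range \<iota>" "x \<noteq> 0"
    and "x \<in> U \<inter> X" "c *s x \<in> U \<inter> X"
  shows "weight \<iota> U X > 1"
proof -
  interpret vs: vector_space "sub_scale \<iota>" by (rule vector_space_sub_scale) fact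
  have nsp: "c *s x \<notin> vs.span {x}"
    using assms(2,3) by (auto simp: vs.span_singleton sub_scale_def)
  then have ind: "vs.independent {c *s x, x}"
    using assms(3) by (simp add: vs.independent_insert)
  obtain B where B: "U \<inter> X \<subseteq> vs.span B" "card B = vs.dim (U \<inter> X)"
    using vs.basis_exists by blast
  have "c *s x \<noteq> x" using nsp vs.span_base by force
  then have "2 = card {c *s x, x}" by simp
  also have "\<dots> \<le> card B"
    using vs.independent_span_bound[OF _ ind, of B] B(1) assms(4,5) by auto
  finally show ?thesis using B(2) by (simp add: weight_def)
qed

text \<open>Converse of \<open>two_le_weight\<close>: two basis vectors of the intersection are both
  multiples of \<open>r\<close>, and their ratio serves as \<open>c\<close>. It avoids
  \<open>range \<iota>\<close> because the vectors are independent over the small field.\<close>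

lemma weight_gt_oneE:
  fixes \<iota> :: "'k::{field,finite} \<Rightarrow> 'a::{field,finite}"
  assumes "field_embedding \<iota>" "weight \<iota> U (vec.span {r}) > 1"
  obtains c t where "c \<notin> range \<iota>" "t \<noteq> 0"
    "t \<in> U \<inter> vec.span {r}" "c *s t \<in> U \<inter> vec.span {r}"
proof -
  interpret vs: vector_space "sub_scale \<iota>" by (rule vector_space_sub_scale) fact
  obtain B where B: "B \<subseteq> U \<inter> vec.span {r}" "vs.independent B"
      "U \<inter> vec.span {r} \<subseteq> vs.span B" "card B = vs.dim (U \<inter> vec.span {r})"
    by (rule vs.basis_exists)
  have "card B \<ge> 2" using assms(2) B(4) by (simp add: weight_def)
  then obtain s t where st: "s \<in> B" "t \<in> B" "s \<noteq> t"
    by (metis card_le_Suc0_iff_eq finite not_less_eq_eq numeral_2_eq_2)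
  have t0: "t \<noteq> 0" using B(2) st(2) vs.dependent_zero by blast
  obtain a b where a: "s = a *s r" and b: "t = b *s r"
    using B(1) st by (fastforce simp: vec.span_singleton)
  from t0 b have "b \<noteq> 0" by auto
  then have s: "s = (a / b) *s t" by (simp add: a b)
  have "a / b \<notin> range \<iota>"
  proof
    assume "a / b \<in> range \<iota>"
    then have "s \<in> vs.span {t}" using s by (auto simp: vs.span_singleton sub_scale_def)
    moreover have "vs.span {t} \<subseteq> vs.span (B - {s})"
      using st by (intro vs.span_mono) auto
    ultimately show False using B(2) st(1) vs.dependent_def by blast
  qed
  then show thesis using that[of "a / b" t] t0 s st B(1) by auto
qed

lemma span_singleton_eq:
  fixes x r :: "'a::field ^ 'n"
  assumes "x \<in> vec.span {r}" "x \<noteq> 0"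
  shows "vec.span {x} = vec.span {r}"
proof -
  obtain a where a: "x = a *s r" using assms(1) by (auto simp: vec.span_singleton)
  with assms(2) have "r = (1 / a) *s x" by auto
  then have "r \<in> vec.span {x}" by (auto simp: vec.span_singleton)
  with assms(1) show ?thesis
    by (intro equalityI vec.span_minimal vec.subspace_span) simp_all
qed

lemma card_span_singleton_le:
  fixes r :: "'a::{field,finite} ^ 'n"
  shows "card (vec.span {r}) \<le> CARD('a)"
  unfolding vec.span_singleton by (rule card_image_le) simp

text \<open>The multiplier \<open>c\<close> that bounds the weight of \<open>P\<close> is taken from
  \<open>Q\<close>. The hypotheses are symmetric in the two points, so this one bound also serves
  for \<open>Q\<close>.\<close>

lemma weight_le_half:
  fixes \<iota> :: "'k::{field,finite} \<Rightarrow> 'a::{field,finite}"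
  assumes emb: "field_embedding \<iota>" and card: "CARD('a) = CARD('k) ^ n"
    and U: "module.subspace (sub_scale \<iota>) U" and "P \<noteq> Q"
    and heavy: "{X \<in> linear_set U. weight \<iota> U X > 1} = {P, Q}"
  shows "2 * weight \<iota> U P \<le> n"
proof -
  interpret vs: vector_space "sub_scale \<iota>" by (rule vector_space_sub_scale) fact
  obtain p where P: "P = vec.span {p}"
    using heavy unfolding linear_set_def by blast
  obtain r where Q: "Q = vec.span {r}" and "weight \<iota> U Q > 1"
    using heavy unfolding linear_set_def by blast
  then obtain c t where c: "c \<notin> range \<iota>" and t: "t \<noteq> 0" "t \<in> U \<inter> Q" "c *s t \<in> U \<inter> Q"
    using weight_gt_oneE[OF emb] by metis
  have "vs.subspace P"
    unfolding vs.subspace_def P sub_scale_def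
    by (auto intro: vec.span_zero vec.span_add vec.span_scale)
  then have W: "vs.subspace (U \<inter> P)" using U vs.subspace_inter by blast
  have trivial: "u = 0" if u: "u \<in> U \<inter> P" "c *s u \<in> U \<inter> P" for u
  proof (rule ccontr)
    assume "u \<noteq> 0"
    have *: "vec.span {u} = P" "vec.span {t} = Q"
      using \<open>u \<noteq> 0\<close> u t P Q span_singleton_eq by auto
    \<comment> \<open>Otherwise \<open>P\<close> would contain the nonzero vector \<open>t\<close>,
      which spans \<open>Q\<close>, and the two points would coincide.\<close>
    have nP: "u + t \<notin> P"
    proof
      assume "u + t \<in> P"
      then have "t \<in> P" using u(1) P by (metis IntD2 vec.span_add_eq)
      then show False using * t(1) P \<open>P \<noteq> Q\<close> span_singleton_eq by metis
    qed
    have nQ: "u + t \<notin> Q"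
    proof
      assume "u + t \<in> Q"
      then have "u \<in> Q" using t(2) Q by (metis IntD2 vec.span_add_eq2)
      then show False using * \<open>u \<noteq> 0\<close> Q \<open>P \<noteq> Q\<close> span_singleton_eq by metis
    qed
    let ?X = "vec.span {u + t}"
    have X: "u + t \<in> ?X" by (simp add: vec.span_base)
    have nz: "u + t \<noteq> 0" using nP P vec.span_zero by metis
    \<comment> \<open>Here it matters that the same \<open>c\<close> works for \<open>u\<close> and
      for \<open>t\<close>: \<open>U\<close> is closed under addition, but not in general under
      scaling by \<open>c\<close>.\<close>
    have inU: "u + t \<in> U" "c *s (u + t) \<in> U"
      using vs.subspace_add[OF U] u t by (auto simp: vec.scale_right_distrib)
    have "weight \<iota> U ?X > 1"
      using two_le_weight[OF emb c nz] inU X vec.span_scale by blast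
    moreover have "?X \<in> linear_set U" unfolding linear_set_def using inU nz by blast
    ultimately have "?X \<in> {P, Q}" using heavy by blast
    then show False using X nP nQ by auto
  qed
  \<comment> \<open>Two pairs with equal images give a vector \<open>v - v'\<close> that lies in
    \<open>U \<inter> P\<close> together with its multiple by \<open>c\<close>, so
    \<open>trivial\<close> makes this map injective. Its values stay in \<open>P\<close>, which is
    closed under all scalars of the large field.\<close>
  let ?f = "\<lambda>(u, v). u + c *s v"
  have "inj_on ?f ((U \<inter> P) \<times> (U \<inter> P))"
  proof (rule inj_onI, clarify)
    fix u v u' v'
    assume "u \<in> U" "u \<in> P" "v \<in> U" "v \<in> P" "u' \<in> U" "u' \<in> P" "v' \<in> U" "v' \<in> P"
      and eq: "u + c *s v = u' + c *s v'"
    then have d: "v - v' \<in> U \<inter> P" "u' - u \<in> U \<inter> P" using vs.subspace_diff[OF W] by auto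
    have "c *s (v - v') = u' - u"
      using eq by (simp add: algebra_simps)
    then have "v - v' = 0" using trivial d by metis
    then show "u = u' \<and> v = v'" using eq by simp
  qed
  moreover have "?f ` ((U \<inter> P) \<times> (U \<inter> P)) \<subseteq> P"
    unfolding P by (auto intro: vec.span_add vec.span_scale)
  ultimately have "card ((U \<inter> P) \<times> (U \<inter> P)) \<le> card P"
    by (metis card_inj_on_le finite)
  then have sq: "card (U \<inter> P) * card (U \<inter> P) \<le> card P"
    by (simp only: card_cartesian_product)
  have "CARD('k) ^ weight \<iota> U P \<le> card (U \<inter> P)"
    unfolding weight_def by (rule card_power_dim_le[OF vs.vector_space_axioms W])
  then have "CARD('k) ^ weight \<iota> U P * CARD('k) ^ weight \<iota> U P \<le> card P"
    using sq by (blast intro: le_trans mult_le_mono)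
  also have "\<dots> \<le> CARD('k) ^ n" using card_span_singleton_le P card by metis
  finally have le: "CARD('k) ^ (2 * weight \<iota> U P) \<le> CARD('k) ^ n"
    by (simp add: mult_2 power_add)
  \<comment> \<open>Comparing exponents requires a base greater than one.\<close>
  have "card {0, 1 :: 'k} \<le> CARD('k)" by (rule card_mono) auto
  then have "CARD('k) > 1" by simp
  then show ?thesis using le power_le_imp_le_exp by blast
qed

theorem theorem4p4:
  fixes \<iota> :: "'k::{field,finite} \<Rightarrow> 'a::{field,finite}"
    and q n :: nat
    and U :: "('a ^ 2) set"
    and L :: "('a ^ 2) set set"
    and P Q :: "('a ^ 2) set"
  assumes "field_embedding \<iota>"
    and "CARD('k) = q"
    and "CARD('a) = q ^ n"
    and "module.subspace (sub_scale \<iota>) U"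
    and "L = linear_set U"
    and "P \<noteq> Q"
    and "{X \<in> L. weight \<iota> U X > 1} = {P, Q}"
  shows "(real (weight \<iota> U P) \<le> real n / 2 \<and> real (weight \<iota> U Q) \<le> real n / 2)
    \<and> (odd n \<longrightarrow> weight \<iota> U P + weight \<iota> U Q < n)
    \<and> (weight \<iota> U P + weight \<iota> U Q = n \<longrightarrow>
         even n \<and> real (weight \<iota> U P) = real n / 2 \<and> real (weight \<iota> U Q) = real n / 2)"
proof -
  have card: "CARD('a) = CARD('k) ^ n" using assms(2,3) by simp
  have heavy: "{X \<in> linear_set U. weight \<iota> U X > 1} = {P, Q}" using assms(5,7) by simp
  then have heavy': "{X \<in> linear_set U. weight \<iota> U X > 1} = {Q, P}" by blast
  have P: "2 * weight \<iota> U P \<le> n"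
    by (rule weight_le_half[OF assms(1) card assms(4,6) heavy])
  have Q: "2 * weight \<iota> U Q \<le> n"
    by (rule weight_le_half[OF assms(1) card assms(4) assms(6)[symmetric] heavy'])
  have "weight \<iota> U P + weight \<iota> U Q < n" if "odd n"
    using P Q that by presburger
  \<comment> \<open>The sum of the two weights reaches \<open>n\<close> only if both bounds are
    attained.\<close>
  moreover have "n = 2 * weight \<iota> U P \<and> n = 2 * weight \<iota> U Q" if "weight \<iota> U P + weight \<iota> U Q = n"
    using P Q that by linarith
  ultimately show ?thesis using P Q by (auto simp: field_simps)
qed

end
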